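(* Let $K\ge 2$, $k\ge 2$ and $n\ge 1$ be integers, let $\gamma>0$, and let $C_1\subseteq[K]^n$ be a code (with at least two codewords) with $\mathrm{LCS}(C_1)=\gamma n$. Then there exist an integer $T=T(K,\gamma,k)$ satisfying $T\le O\big((2k/\gamma)^{2K+2}\big)$ and an injective map $\tau\colon[K]\to[k]^T$ such that the code $C_2\subseteq[k]^N$, $N=nT$, obtained by replacing each symbol of each codeword of $C_1$ by its image under $\tau$, has the following property: if $s$ is a common subsequence between two distinct codewords $c,\tilde c\in C_2$, then \[\operatorname{span} s\ \ge\ (k+\sqrt k)\,\operatorname{len} s-5\gamma kN.\] In particular, $\mathrm{LCS}(C_2)\le \frac{2+5\gamma k}{k+\sqrt k}N<\left(\frac{2}{k+\sqrt k}+5\gamma\right)N$.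
   Context: $[k]=\{1,\dots,k\}$. A word is a finite sequence of symbols; symbols are treated as distinguishable positions. A subsequence of a word $w$ is obtained by deleting symbols; a subword is a subsequence of consecutive symbols. The span $\operatorname{span}_w w'$ of a subsequence $w'$ of $w$ is the length of the shortest subword of $w$ containing $w'$. A common subsequence of words $w_1,w_2$ is a pair $s=(w_1',w_2')$ of subsequences $w_1'$ of $w_1$ and $w_2'$ of $w_2$ that are equal as words; $\operatorname{len} s$ is their common length and $\operatorname{span} s=\operatorname{span}_{w_1}w_1'+\operatorname{span}_{w_2}w_2'$. $\mathrm{LCS}(w_1,w_2)$ is the maximum length of a common subsequence, and for a code $C$ (a set of words of equal length), $\mathrm{LCS}(C)=\max_{c_1\ne c_2\in C}\mathrm{LCS}(c_1,c_2)$. *)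

theory Defs
  imports Complex_Main
begin

text \<open>Words are lists of naturals; a word over [K] of length n has all letters in {1..K}.
Subsequences are sets of positions (positions are distinguishable).\<close>

definition words :: "nat \<Rightarrow> nat \<Rightarrow> nat list set" where
  "words K n = {w. length w = n \<and> set w \<subseteq> {1..K}}"

definition span_pos :: "nat set \<Rightarrow> nat" where
  "span_pos I = (if I = {} then 0 else Max I - Min I + 1)"

definition common_subseq :: "nat list \<Rightarrow> nat list \<Rightarrow> nat set \<times> nat set \<Rightarrow> bool" where
  "common_subseq w1 w2 s \<longleftrightarrow>
     fst s \<subseteq> {..<length w1} \<and> snd s \<subseteq> {..<length w2} \<and>
     nths w1 (fst s) = nths w2 (snd s)"

definition len_cs :: "nat set \<times> nat set \<Rightarrow> nat" where
  "len_cs s = card (fst s)"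

definition span_cs :: "nat set \<times> nat set \<Rightarrow> nat" where
  "span_cs s = span_pos (fst s) + span_pos (snd s)"

definition LCS :: "nat list \<Rightarrow> nat list \<Rightarrow> nat" where
  "LCS w1 w2 = Max (len_cs ` {s. common_subseq w1 w2 s})"

definition LCS_code :: "nat list set \<Rightarrow> nat" where
  "LCS_code C = Max {LCS c1 c2 | c1 c2. c1 \<in> C \<and> c2 \<in> C \<and> c1 \<noteq> c2}"

definition encode :: "(nat \<Rightarrow> nat list) \<Rightarrow> nat list \<Rightarrow> nat list" where
  "encode \<tau> c = concat (map \<tau> c)"

end

theory Submission
  imports Defs
begin

text \<open>The image of the letter \<open>a\<close> has two length scales \<open>r\<close> and \<open>R\<close>. It runs cyclically through
  stretches of length \<open>R\<close>, one for each majority symbol \<open>m\<close>; inside a stretch it repeats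
  \<open>1\<^sup>r 2\<^sup>r \<dots> k\<^sup>r m\<^sup>x\<close> with \<open>x \<approx> r \<surd>k\<close>. There \<open>m\<close> has density \<open>1/\<surd>k\<close>, every other symbol
  has density \<open>1/(k + \<surd>k)\<close>, and over a full cycle all symbols have density \<open>1/k\<close>. As \<open>a\<close> grows,
  \<open>r\<close> decreases and \<open>R\<close> increases, by factors \<open>\<rho> \<approx> k/\<gamma>\<close>. Match the word of \<open>a\<close> with that of
  \<open>b > a\<close>. Runs of the first word are long compared with the fine structure of the second, so a
  matched symbol costs \<open>k + \<surd>k\<close> in the second word alone unless it is the current majority
  symbol there, when it costs \<open>\<surd>k\<close>. But a stretch of the second word is long compared with the
  cycles of the first, where the same symbol costs \<open>k\<close> on average.

  A common subsequence of two codewords is cut along the block boundaries into at most \<open>2n\<close> pieces.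
  Pieces between different letters satisfy the bound above with an error of \<open>3\<gamma>kT/2\<close> each.
  Pieces between equal letters have total length at most \<open>T\<close> times the LCS in the outer code.\<close>

section \<open>Matchings as chains of position pairs\<close>

text \<open>A common subsequence is handled as its set of matched position pairs. Unlike a pair of
  position sets, this form can be restricted to any subset of the matches.\<close>

definition strict_chain :: "(nat \<times> nat) set \<Rightarrow> bool" where
  "strict_chain M \<longleftrightarrow> (\<forall>p\<in>M. \<forall>q\<in>M. p \<noteq> q \<longrightarrow>
     (fst p < fst q \<and> snd p < snd q) \<or> (fst q < fst p \<and> snd q < snd p))"

lemma strict_chain_subset: "strict_chain M \<Longrightarrow> N \<subseteq> M \<Longrightarrow> strict_chain N"
  unfolding strict_chain_def by blast

lemma strict_chain_cases:
  assumes "strict_chain M" "p \<in> M" "q \<in> M"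
  obtains "p = q" | "fst p < fst q" "snd p < snd q" | "fst q < fst p" "snd q < snd p"
  using assms unfolding strict_chain_def by blast

lemma strict_chain_inj_fst: "strict_chain M \<Longrightarrow> inj_on fst M"
  unfolding strict_chain_def inj_on_def by (metis less_irrefl)

lemma strict_chain_inj_snd: "strict_chain M \<Longrightarrow> inj_on snd M"
  unfolding strict_chain_def inj_on_def by (metis less_irrefl)

section \<open>Spans and their additivity over consecutive pieces\<close>

text \<open>As a cardinality, the span is monotone, and additive over disjoint hulls, by plain
  counting.\<close>

lemma span_pos_eq_card_hull:
  assumes "finite X"
  shows "span_pos X = card {z. \<exists>x\<in>X. \<exists>y\<in>X. x \<le> z \<and> z \<le> y}"
proof (cases "X = {}")
  case False
  have "{z. \<exists>x\<in>X. \<exists>y\<in>X. x \<le> z \<and> z \<le> y} = {Min X..Max X}"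
  proof (intro set_eqI iffI)
    fix z assume "z \<in> {z. \<exists>x\<in>X. \<exists>y\<in>X. x \<le> z \<and> z \<le> y}"
    then obtain x y where "x \<in> X" "y \<in> X" "x \<le> z" "z \<le> y" by blast
    then show "z \<in> {Min X..Max X}"
      using Min_le[OF assms, of x] Max_ge[OF assms, of y] by simp
  next
    fix z assume "z \<in> {Min X..Max X}"
    then show "z \<in> {z. \<exists>x\<in>X. \<exists>y\<in>X. x \<le> z \<and> z \<le> y}"
      using Min_in[OF assms False] Max_in[OF assms False] by auto
  qed
  moreover have "Min X \<le> Max X"
    using assms False by simp
  ultimately show ?thesis
    using False by (simp add: span_pos_def)
qed (simp add: span_pos_def)

lemma finite_hull:
  fixes X :: "nat set"
  assumes "finite X"
  shows "finite {z. \<exists>x\<in>X. \<exists>y\<in>X. x \<le> z \<and> z \<le> y}"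
  by (rule finite_subset[of _ "{..Max X}"]) (auto dest!: Max_ge[OF assms])

lemma span_pos_mono:
  assumes "finite Y" "X \<subseteq> Y"
  shows "span_pos X \<le> span_pos Y"
proof -
  have "finite X" using assms finite_subset by blast
  then show ?thesis
    using assms by (auto simp: span_pos_eq_card_hull intro!: card_mono finite_hull)
qed

lemma span_pos_le:
  assumes "X \<subseteq> {..<N}"
  shows "span_pos X \<le> N"
proof -
  have f: "finite X" using assms finite_subset by blast
  have "card {z. \<exists>x\<in>X. \<exists>y\<in>X. x \<le> z \<and> z \<le> y} \<le> card {..<N}"
    by (rule card_mono) (use assms in auto)
  then show ?thesis using f by (simp add: span_pos_eq_card_hull)
qed

lemma span_pos_shift:
  assumes "finite X"
  shows "span_pos ((\<lambda>x. c + x) ` X) = span_pos X"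
proof (cases "X = {}")
  case False
  have "Min ((\<lambda>x. c + x) ` X) = c + Min X" "Max ((\<lambda>x. c + x) ` X) = c + Max X"
    using assms False by (auto simp: mono_Min_commute[symmetric] mono_Max_commute[symmetric] monoI)
  then show ?thesis
    using False by (simp add: span_pos_def)
qed (simp add: span_pos_def)

text \<open>Classes of a key that increases with position have disjoint hulls, since a common point
  would force an inversion. All of these hulls lie in the hull of the whole set.\<close>

lemma sum_span_pos_le:
  fixes key :: "'a \<Rightarrow> nat"
  assumes fin: "finite M"
    and mono: "\<And>p q. p \<in> M \<Longrightarrow> q \<in> M \<Longrightarrow> \<pi> p \<le> \<pi> q \<Longrightarrow> key p \<le> key q"
  shows "(\<Sum>d\<in>key ` M. span_pos (\<pi> ` {p\<in>M. key p = d})) \<le> span_pos (\<pi> ` M)"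
proof -
  define H where "H X = {z::nat. \<exists>x\<in>X. \<exists>y\<in>X. x \<le> z \<and> z \<le> y}" for X
  let ?X = "\<lambda>d. \<pi> ` {p\<in>M. key p = d}"
  have "(\<Sum>d\<in>key ` M. span_pos (?X d)) = (\<Sum>d\<in>key ` M. card (H (?X d)))"
    using fin by (intro sum.cong) (auto simp: span_pos_eq_card_hull H_def)
  also have "\<dots> = card (\<Union>d\<in>key ` M. H (?X d))"
  proof (rule card_UN_disjoint[symmetric])
    show "\<forall>d\<in>key ` M. finite (H (?X d))"
      unfolding H_def using fin by (auto intro!: finite_hull)
    have "H (?X d) \<inter> H (?X e) = {}" if "d < e" for d e
    proof (rule ccontr)
      assume "H (?X d) \<inter> H (?X e) \<noteq> {}"
      then obtain z p q where "p \<in> M" "key p = d" "z \<le> \<pi> p" "q \<in> M" "key q = e" "\<pi> q \<le> z"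
        unfolding H_def by blast
      with mono[of q p] that show False by simp
    qed
    then have "H (?X d) \<inter> H (?X e) = {}" if "d \<noteq> e" for d e
      using that by (cases "d < e") (simp, subst inf_commute, simp)
    then show "\<forall>d\<in>key ` M. \<forall>e\<in>key ` M. d \<noteq> e \<longrightarrow> H (?X d) \<inter> H (?X e) = {}"
      by blast
  qed (use fin in simp)
  also have "\<dots> \<le> card (H (\<pi> ` M))"
    unfolding H_def using fin by (intro card_mono finite_hull) auto
  also have "\<dots> = span_pos (\<pi> ` M)"
    using fin by (simp add: span_pos_eq_card_hull H_def)
  finally show ?thesis .
qed

text \<open>Local bounds add up: the spans of the classes sum to at most the total span, and the
  boundary error \<open>E\<close> is paid once per class.\<close>

lemma sum_weight_le_span_pos:
  fixes key :: "'a \<Rightarrow> nat" and wt :: "'a \<Rightarrow> real" and E :: real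
  assumes fin: "finite M"
    and mono: "\<And>p q. p \<in> M \<Longrightarrow> q \<in> M \<Longrightarrow> \<pi> p \<le> \<pi> q \<Longrightarrow> key p \<le> key q"
    and piece: "\<And>d. d \<in> key ` M \<Longrightarrow>
      (\<Sum>p\<in>{p\<in>M. key p = d}. wt p) \<le> span_pos (\<pi> ` {p\<in>M. key p = d}) + E"
    and bound: "key ` M \<subseteq> {..<N}" and "E \<ge> 0"
  shows "(\<Sum>p\<in>M. wt p) \<le> span_pos (\<pi> ` M) + real N * E"
proof -
  have "(\<Sum>p\<in>M. wt p) = (\<Sum>d\<in>key ` M. \<Sum>p\<in>{p\<in>M. key p = d}. wt p)"
    using fin by (rule sum.image_gen)
  also have "\<dots> \<le> (\<Sum>d\<in>key ` M. real (span_pos (\<pi> ` {p\<in>M. key p = d})) + E)"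
    by (rule sum_mono) (rule piece)
  also have "\<dots> = real (\<Sum>d\<in>key ` M. span_pos (\<pi> ` {p\<in>M. key p = d})) + real (card (key ` M)) * E"
    by (simp add: sum.distrib)
  also have "\<dots> \<le> span_pos (\<pi> ` M) + real N * E"
  proof (intro add_mono mult_right_mono)
    show "real (\<Sum>d\<in>key ` M. span_pos (\<pi> ` {p\<in>M. key p = d})) \<le> real (span_pos (\<pi> ` M))"
      using sum_span_pos_le[of M \<pi> key, OF fin mono] by (intro of_nat_mono)
    show "real (card (key ` M)) \<le> real N"
      using card_mono[OF _ bound] by simp
  qed (use \<open>E \<ge> 0\<close> in simp)
  finally show ?thesis .
qed

section \<open>From densities in windows to spans\<close>

lemma card_mod_window_le:
  fixes P :: nat
  assumes "P > 0"
  shows "card ({t. \<phi> (t mod P)} \<inter> {z..<z+P}) \<le> card {v. v < P \<and> \<phi> v}"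
proof (rule card_inj_on_le)
  have False if "a < b" "b < z + P" "z \<le> a" "a mod P = b mod P" for a b
  proof -
    have "P dvd b - a"
      using that by (metis mod_eq_dvd_iff_nat less_imp_le)
    then show False
      using that dvd_imp_le[of P "b - a"] by linarith
  qed
  then show "inj_on (\<lambda>t. t mod P) ({t. \<phi> (t mod P)} \<inter> {z..<z+P})"
    by (intro linorder_inj_onI') auto
qed (use assms in auto)

text \<open>Turns a density \<open>h / P\<close> into a cost of \<open>c\<close> per element.
  Cutting the span of \<open>Y\<close> into windows of length \<open>P\<close> leaves one remainder,
  which alone causes the error \<open>P - h\<close>.\<close>

lemma card_le_span_pos:
  fixes c :: real
  assumes window: "\<And>z. card (S \<inter> {z..<z+P}) \<le> h" and h: "0 < h" "h \<le> P" "c * h \<le> P"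
    and Y: "finite Y" "Y \<subseteq> S"
  shows "c * card Y \<le> span_pos Y + (real P - real h)"
proof (cases "Y = {}")
  case True
  then show ?thesis using h by (simp add: span_pos_def)
next
  case False
  define m t where "m = span_pos Y div P" and "t = span_pos Y mod P"
  have sp: "span_pos Y = m * P + t" by (simp add: m_def t_def)
  have tP: "t < P" using h by (simp add: t_def)
  have multi: "card (S \<inter> {z..<z+m*P}) \<le> m * h" for z m
  proof (induction m)
    case (Suc m)
    have "S \<inter> {z..<z+Suc m*P} \<subseteq> (S \<inter> {z..<z+m*P}) \<union> (S \<inter> {z+m*P..<z+m*P+P})"
      by auto
    then have "card (S \<inter> {z..<z+Suc m*P}) \<le> card (S \<inter> {z..<z+m*P}) + card (S \<inter> {z+m*P..<z+m*P+P})"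
      by (meson card_Un_le card_mono finite_Int finite_Un finite_atLeastLessThan le_trans)
    then show ?case using Suc window[of "z+m*P"] by simp
  qed simp
  let ?a = "Min Y"
  have "Min Y \<le> Max Y" using Y False by simp
  then have "Y \<subseteq> {?a..<?a + span_pos Y}"
    using False by (auto simp: span_pos_def less_Suc_eq_le intro: Min_le[OF Y(1)] Max_ge[OF Y(1)])
  then have "Y \<subseteq> (S \<inter> {?a..<?a+m*P}) \<union> (S \<inter> {?a+m*P..<?a+m*P+t})"
    using Y sp by auto
  then have "card Y \<le> card (S \<inter> {?a..<?a+m*P}) + card (S \<inter> {?a+m*P..<?a+m*P+t})"
    by (meson card_Un_le card_mono finite_Int finite_Un finite_atLeastLessThan le_trans)
  moreover have "card (S \<inter> {?a+m*P..<?a+m*P+t}) \<le> t"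
    using card_mono[of "{?a+m*P..<?a+m*P+t}" "S \<inter> {?a+m*P..<?a+m*P+t}"] by simp
  moreover have "card (S \<inter> {?a+m*P..<?a+m*P+t}) \<le> h"
    by (rule order_trans[OF card_mono window[of "?a+m*P"]]) (use tP in auto)
  ultimately have "card Y \<le> m * h + min t h"
    using multi[where m = m, of ?a] by linarith
  then have cY: "real (card Y) \<le> m * h + min t h"
    by (metis of_nat_add of_nat_le_iff of_nat_mult)
  \<comment> \<open>Replacing \<open>c\<close> by the exact ratio \<open>P / h\<close> makes every
    full window break even.\<close>
  define d where "d = real P / h"
  have d: "c \<le> d" "d \<ge> 1" "d * h = P" using h by (auto simp: d_def field_simps)
  have "c * card Y \<le> d * card Y" using d by (intro mult_right_mono) auto
  also have "\<dots> \<le> d * (m * h + min t h)" using d cY by (intro mult_left_mono) auto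
  also have "\<dots> = m * P + d * min t h" using d by (simp add: algebra_simps)
  \<comment> \<open>The worst remainder has length \<open>t = h\<close> and consists of elements
    only: it is charged \<open>P\<close> but contributes just \<open>h\<close> to the span.\<close>
  also have "d * min t h \<le> t + (real P - h)"
  proof (cases "t \<le> h")
    case True
    then have "(d - 1) * t \<le> (d - 1) * h" using d by (intro mult_left_mono) auto
    then show ?thesis using d True by (simp add: algebra_simps)
  next
    case False
    then show ?thesis using d by simp
  qed
  finally show ?thesis using sp by simp
qed

section \<open>The two-scale words and their letter counts\<close>

text \<open>\<open>P\<close> is the length of one repetition of the pattern, so
  \<open>x = P - k * r\<close>. Later \<open>R\<close> has the form \<open>P * g\<close>, which
  makes every stretch consist of whole repetitions.\<close>

definition dirty_letter :: "nat \<Rightarrow> nat \<Rightarrow> nat \<Rightarrow> nat \<Rightarrow> nat \<Rightarrow> nat" where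
  "dirty_letter k r P R t =
     Suc (if t mod P < k * r then (t mod P) div r else (t div R) mod k)"

text \<open>Indexes the maximal segments on which the word is constant by construction: \<open>k + 1\<close> per
  period \<open>P\<close>, the last one being the majority segment.\<close>

definition clean_run :: "nat \<Rightarrow> nat \<Rightarrow> nat \<Rightarrow> nat \<Rightarrow> nat" where
  "clean_run k r P t = (t div P) * Suc k + min k ((t mod P) div r)"

lemma dirty_letter_bounds:
  assumes "k > 0"
  shows "dirty_letter k r P R t \<in> {1..k}"
  using assms less_mult_imp_div_less[of "t mod P" k r]
  by (auto simp: dirty_letter_def Suc_le_eq)

lemma clean_run_mono:
  assumes "t \<le> u"
  shows "clean_run k r P t \<le> clean_run k r P u"
proof (cases "t div P = u div P")
  case True
  have "t mod P \<le> u mod P"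
    using assms True by (metis div_mult_mod_eq nat_add_left_cancel_le)
  then show ?thesis
    using True div_le_mono[of "t mod P" "u mod P" r] by (auto simp: clean_run_def)
next
  case False
  then have "Suc (t div P) \<le> u div P"
    using div_le_mono[OF assms, of P] by simp
  then have "Suc (t div P) * Suc k \<le> (u div P) * Suc k"
    by (rule mult_le_mono1)
  then show ?thesis
    unfolding clean_run_def by (simp add: min_def)
qed

lemma clean_run_less:
  assumes "t < P * u"
  shows "clean_run k r P t < u * Suc k"
proof -
  have "Suc (t div P) \<le> u"
    using assms by (simp add: Suc_le_eq less_mult_imp_div_less mult.commute)
  then have "Suc (t div P) * Suc k \<le> u * Suc k"
    by (rule mult_le_mono1)
  then show ?thesis
    unfolding clean_run_def by (simp add: min_def)
qed

text \<open>Quotient and remainder of the run index by \<open>Suc k\<close> recover the period and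
  the segment in it. As the stretch length is a multiple of \<open>P\<close>, the majority symbol
  depends on the period only.\<close>

lemma dirty_letter_clean_run:
  assumes "clean_run k r P t = clean_run k r P u" and "r > 0"
  shows "dirty_letter k r P (P * g) t = dirty_letter k r P (P * g) u"
proof -
  have dv: "clean_run k r P v div Suc k = v div P"
    and md: "clean_run k r P v mod Suc k = min k ((v mod P) div r)" for v
    unfolding clean_run_def by (simp_all add: add.commute[of _ "min _ _"] del: mult_Suc_right)
  have 1: "t div P = u div P" using dv[of t] dv[of u] assms by simp
  have 2: "min k ((t mod P) div r) = min k ((u mod P) div r)"
    using md[of t] md[of u] assms by simp
  have 3: "v mod P < k * r \<longleftrightarrow> (v mod P) div r < k" for v
    using assms by (simp add: div_less_iff_less_mult)
  show ?thesis
    using 1 2 unfolding dirty_letter_def 3 div_mult2_eq by (auto simp: min_def split: if_splits)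
qed

lemma card_div_mod_le:
  fixes P :: nat
  assumes "finite A" "finite B"
  shows "card {v. v div P \<in> A \<and> v mod P \<in> B} \<le> card A * card B"
proof -
  have "card {v. v div P \<in> A \<and> v mod P \<in> B} \<le> card (A \<times> B)"
  proof (rule card_inj_on_le)
    show "inj_on (\<lambda>v. (v div P, v mod P)) {v. v div P \<in> A \<and> v mod P \<in> B}"
      by (rule inj_onI) (metis div_mult_mod_eq prod.inject)
  qed (use assms in auto)
  then show ?thesis by (simp add: card_cartesian_product)
qed

lemma div_eq_interval:
  fixes v :: nat
  assumes "r > 0"
  shows "v div r = a \<longleftrightarrow> v \<in> {a * r..<a * r + r}"
proof
  assume "v div r = a"
  then show "v \<in> {a * r..<a * r + r}"
    using div_mult_mod_eq[of v r] mod_less_divisor[OF assms, of v] by (simp del: div_mult_mod_eq)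
next
  assume "v \<in> {a * r..<a * r + r}"
  then show "v div r = a"
    by (intro div_nat_eqI) (auto simp: mult.commute)
qed

text \<open>A cycle of \<open>k\<close> stretches has \<open>k * g\<close> periods. A symbol gets
  \<open>r\<close> positions in each of them and \<open>x\<close> more in each of the
  \<open>g\<close> periods of its own stretch. The total \<open>k * g * r + g * x = P * g\<close> is
  one \<open>k\<close>-th of the cycle.\<close>

lemma card_dirty_letter_window:
  assumes P: "P = k * r + x" and "r > 0" "g > 0" "k > 0" "a < k"
  shows "card ({t. dirty_letter k r P (P * g) t = Suc a} \<inter> {z..<z + k * (P * g)}) \<le> P * g"
proof -
  have Ppos: "P > 0" using assms by simp
  let ?\<phi> = "\<lambda>v. dirty_letter k r P (P * g) v = Suc a"
  have per: "?\<phi> t \<longleftrightarrow> ?\<phi> (t mod (k * (P * g)))" for t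
  proof -
    have "t mod (k * (P * g)) mod P = t mod P"
      by (simp add: mod_mod_cancel)
    moreover have "t mod (k * (P * g)) div (P * g) = t div (P * g) mod k"
      using assms(3) Ppos by (subst mult.commute[of k], subst mod_mult2_eq) simp
    ultimately show ?thesis unfolding dirty_letter_def by simp
  qed
  have "{t. ?\<phi> t} = {t. ?\<phi> (t mod (k * (P * g)))}"
    using per by blast
  then have "card ({t. ?\<phi> t} \<inter> {z..<z + k * (P * g)}) \<le> card {v. v < k * (P * g) \<and> ?\<phi> v}"
    using card_mod_window_le[of "k * (P * g)" ?\<phi> z] assms Ppos by simp
  \<comment> \<open>The first set holds the ordinary runs of the symbol, the second the majority
    tails of its own stretch.\<close>
  also have "\<dots> \<le> card ({v. v div P \<in> {..<k * g} \<and> v mod P \<in> {a * r..<a * r + r}} \<union>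
                     {v. v div P \<in> {a * g..<a * g + g} \<and> v mod P \<in> {k * r..<P}})"
  proof (rule card_mono)
    show "finite ({v. v div P \<in> {..<k * g} \<and> v mod P \<in> {a * r..<a * r + r}} \<union>
                     {v. v div P \<in> {a * g..<a * g + g} \<and> v mod P \<in> {k * r..<P}})"
    proof (rule finite_subset[of _ "{..<P * (k * g + a * g + g)}"], rule subsetI)
      fix v assume "v \<in> {v. v div P \<in> {..<k * g} \<and> v mod P \<in> {a * r..<a * r + r}} \<union>
                     {v. v div P \<in> {a * g..<a * g + g} \<and> v mod P \<in> {k * r..<P}}"
      then have "v div P < k * g + a * g + g" by auto
      then show "v \<in> {..<P * (k * g + a * g + g)}"
        using Ppos by (simp add: div_less_iff_less_mult mult.commute)
    qed simp
    show "{v. v < k * (P * g) \<and> ?\<phi> v} \<subseteq>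
       {v. v div P \<in> {..<k * g} \<and> v mod P \<in> {a * r..<a * r + r}} \<union>
       {v. v div P \<in> {a * g..<a * g + g} \<and> v mod P \<in> {k * r..<P}}"
    proof
      fix v assume v: "v \<in> {v. v < k * (P * g) \<and> ?\<phi> v}"
      then have vk: "v div P < k * g"
        using Ppos by (simp add: div_less_iff_less_mult algebra_simps)
      then have "v div P div g < k"
        using assms by (simp add: div_less_iff_less_mult)
      then have m: "v div (P * g) mod k = v div P div g"
        by (simp add: div_mult2_eq)
      show "v \<in> {v. v div P \<in> {..<k * g} \<and> v mod P \<in> {a * r..<a * r + r}} \<union>
       {v. v div P \<in> {a * g..<a * g + g} \<and> v mod P \<in> {k * r..<P}}"
      proof (cases "v mod P < k * r")
        case True
        then have "(v mod P) div r = a" using v by (simp add: dirty_letter_def)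
        then have "v mod P \<in> {a * r..<a * r + r}" using div_eq_interval[OF assms(2)] by blast
        then show ?thesis using vk by blast
      next
        case False
        then have "v div P div g = a" using v m by (simp add: dirty_letter_def)
        then have "v div P \<in> {a * g..<a * g + g}" using div_eq_interval[OF assms(3)] by blast
        then show ?thesis using False Ppos by simp
      qed
    qed
  qed
  also have "\<dots> \<le> k * g * r + g * x"
    using card_div_mod_le[of "{..<k * g}" "{a * r..<a * r + r}" P]
      card_div_mod_le[of "{a * g..<a * g + g}" "{k * r..<P}" P] P
    by (intro order_trans[OF card_Un_le]) simp
  also have "\<dots> = P * g" using P by (simp add: algebra_simps)
  finally show ?thesis .
qed

text \<open>Applied to symbols other than the current majority symbol, which occur only in their
  ordinary runs.\<close>

lemma card_minority_window:
  assumes P: "P = k * r + x" and "r > 0"  "k > 0"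
  shows "card ({t. t mod P div r = b} \<inter> {z..<z + P}) \<le> r"
proof -
  have "card ({t. t mod P div r = b} \<inter> {z..<z + P}) \<le> card {v. v < P \<and> v div r = b}"
    using card_mod_window_le[of P "\<lambda>v. v div r = b" z] assms by simp
  also have "\<dots> \<le> card {b * r..<b * r + r}"
    by (intro card_mono) (auto simp: div_eq_interval[OF assms(2)])
  finally show ?thesis by simp
qed

text \<open>Applied to the current majority symbol, which has its ordinary run and the tail of each
  period.\<close>

lemma card_majority_window:
  assumes P: "P = k * r + x" and "r > 0"  "k > 0"
  shows "card ({t. t mod P div r = a \<or> k * r \<le> t mod P} \<inter> {z..<z + P}) \<le> r + x"
proof -
  have "card ({t. t mod P div r = a \<or> k * r \<le> t mod P} \<inter> {z..<z + P}) \<le>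
      card {v. v < P \<and> (v div r = a \<or> k * r \<le> v)}"
    using card_mod_window_le[of P "\<lambda>v. v div r = a \<or> k * r \<le> v" z] assms by simp
  also have "\<dots> \<le> card ({a * r..<a * r + r} \<union> {k * r..<P})"
    by (intro card_mono) (auto simp: div_eq_interval[OF assms(2)])
  also have "\<dots> \<le> r + x"
    using P by (intro order_trans[OF card_Un_le]) simp
  finally show ?thesis .
qed

section \<open>Matching two words of different scales\<close>

text \<open>Each pair is charged to the two spans. A pair on the current majority symbol of the
  second word (the set \<open>A\<close>) is charged \<open>k\<close> in the first word and
  \<open>sqrt k - \<epsilon>\<close> in the second. Any other pair is charged
  \<open>k + sqrt k\<close> in the second word alone. The slack \<open>\<epsilon>\<close> absorbs
  the rounding of \<open>x2\<close>. The first word has \<open>u\<close> periods, the second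
  \<open>v\<close> stretches.\<close>

lemma span_dirty_words:
  fixes k r1 x1 P1 g1 r2 x2 P2 g2 u v T :: nat and \<epsilon> :: real
  assumes k: "k \<ge> 2"
    and P1: "P1 = k * r1 + x1" "r1 > 0" "g1 > 0"
    and P2: "P2 = k * r2 + x2" "r2 > 0" "g2 > 0"
    and x2: "sqrt k * r2 \<le> x2" "x2 \<le> sqrt k * r2 + \<epsilon> * r2" and "\<epsilon> \<ge> 0"
    and T: "T = P1 * u" "T = P2 * g2 * v"
    and M: "finite M" "strict_chain M" "fst ` M \<subseteq> {..<T}" "snd ` M \<subseteq> {..<T}"
    and eq: "\<And>p. p \<in> M \<Longrightarrow>
      dirty_letter k r1 P1 (P1 * g1) (fst p) = dirty_letter k r2 P2 (P2 * g2) (snd p)"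
  shows "(k + sqrt k - \<epsilon>) * card M \<le> real (span_pos (fst ` M)) + real (span_pos (snd ` M))
     + v * ((real k - 1) * (P1 * g1)) + real (v + u * Suc k) * real P2"
proof -
  define R1 R2 where "R1 = P1 * g1" and "R2 = P2 * g2"
  define D where "D p = snd p div R2" for p :: "nat \<times> nat"
  define C where "C p = clean_run k r1 P1 (fst p)" for p :: "nat \<times> nat"
  define l where "l p = dirty_letter k r1 P1 R1 (fst p)" for p :: "nat \<times> nat"
  define A where "A = {p\<in>M. l p = Suc (D p mod k)}"
  have R1: "R1 > 0" and R2: "R2 > 0" using P1 P2 k by (auto simp: R1_def R2_def)
  have A: "A \<subseteq> M" "finite A" using M by (auto simp: A_def)
  have le: "fst p \<le> fst q \<longleftrightarrow> snd p \<le> snd q" if "p \<in> M" "q \<in> M" for p q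
    by (rule strict_chain_cases[OF M(2) that]) auto
  have Dmono: "D p \<le> D q" if "p \<in> M" "q \<in> M" "snd p \<le> snd q" for p q
    using that by (simp add: D_def div_le_mono)
  have Cmono: "C p \<le> C q" if "p \<in> M" "q \<in> M" "fst p \<le> fst q" for p q
    using that by (simp add: C_def clean_run_mono)
  have Dv: "D p < v" if "p \<in> M" for p
  proof -
    have "snd p < R2 * v" using that M T by (auto simp: R2_def)
    then show ?thesis by (simp add: D_def less_mult_imp_div_less mult.commute)
  qed
  have Cu: "C p < u * Suc k" if "p \<in> M" for p
  proof -
    have "fst p < P1 * u" using that M T by auto
    then show ?thesis unfolding C_def by (rule clean_run_less)
  qed

  \<comment> \<open>Within one stretch of the second word all pairs of \<open>A\<close> carry the
    same symbol, of density \<open>1 / k\<close> over full cycles of the first word. Each of the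
    \<open>v\<close> stretches may lose one incomplete cycle.\<close>
  have "(\<Sum>p\<in>A. real k) \<le> real (span_pos (fst ` A)) + real v * ((real k - 1) * R1)"
  proof (rule sum_weight_le_span_pos[where key = D])
    show "D p \<le> D q" if "p \<in> A" "q \<in> A" "fst p \<le> fst q" for p q
      using that A le Dmono by blast
    show "D ` A \<subseteq> {..<v}" using A Dv by auto
    show "(real k - 1) * R1 \<ge> 0" using k by simp
    fix d
    let ?X = "{p\<in>A. D p = d}"
    have "card (fst ` ?X) = card ?X"
      by (intro card_image inj_on_subset[OF strict_chain_inj_fst[OF M(2)]]) (use A in auto)
    moreover have "real k * card (fst ` ?X) \<le> span_pos (fst ` ?X) + (real (k * R1) - real R1)"
    proof (rule card_le_span_pos)
      show "card ({t. dirty_letter k r1 P1 (P1 * g1) t = Suc (d mod k)} \<inter> {z..<z + k * R1}) \<le> R1" for z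
        unfolding R1_def using P1 k by (intro card_dirty_letter_window) auto
      show "fst ` ?X \<subseteq> {t. dirty_letter k r1 P1 (P1 * g1) t = Suc (d mod k)}"
        by (auto simp: A_def l_def R1_def)
    qed (use R1 k A in auto)
    ultimately show "(\<Sum>p\<in>?X. real k) \<le> real (span_pos (fst ` ?X)) + (real k - 1) * R1"
      by (simp add: algebra_simps)
  qed (use A in simp)
  then have 1: "real k * card A \<le> real (span_pos (fst ` A)) + real v * ((real k - 1) * R1)"
    by (simp add: mult.commute)

  \<comment> \<open>Cutting at the stretches of the second word and the runs of the first leaves a
    single symbol and a single majority symbol per piece. Each piece loses at most one period
    \<open>P2\<close>.\<close>
  have "(\<Sum>p\<in>M. if p \<in> A then sqrt k - \<epsilon> else k + sqrt k)
      \<le> real (span_pos (snd ` M)) + real (v + u * Suc k) * real P2"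
  proof (rule sum_weight_le_span_pos[where key = "\<lambda>p. D p + C p"])
    show "D p + C p \<le> D q + C q" if "p \<in> M" "q \<in> M" "snd p \<le> snd q" for p q
      using that le Dmono Cmono by (meson add_mono)
    show "(\<lambda>p. D p + C p) ` M \<subseteq> {..<v + u * Suc k}"
      using Dv Cu by (fastforce intro: add_strict_mono)
    fix d assume "d \<in> (\<lambda>p. D p + C p) ` M"
    then obtain p0 where p0: "p0 \<in> M" "D p0 + C p0 = d" by blast
    let ?X = "{p\<in>M. D p + C p = d}"
    \<comment> \<open>Both indices are monotone along the chain, so equal sums force equal
      summands.\<close>
    have same: "D p = D p0 \<and> C p = C p0" if "p \<in> ?X" for p
    proof (cases "fst p \<le> fst p0")
      case True
      then show ?thesis using that p0 le[of p p0] Dmono[of p p0] Cmono[of p p0] by auto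
    next
      case False
      then show ?thesis using that p0 le[of p0 p] Dmono[of p0 p] Cmono[of p0 p] by auto
    qed
    have lp: "l p = l p0" if "p \<in> ?X" for p
      using same[OF that] P1 dirty_letter_clean_run unfolding l_def C_def R1_def by blast
    have card: "card (snd ` ?X) = card ?X"
      by (intro card_image inj_on_subset[OF strict_chain_inj_snd[OF M(2)]]) auto
    have fin: "finite (snd ` ?X)" using M by simp
    have l2: "dirty_letter k r2 P2 R2 (snd p) = l p0" "snd p div R2 mod k = D p0 mod k"
      if "p \<in> ?X" for p
      using lp[OF that] same[OF that] eq[of p] that by (auto simp: l_def R1_def R2_def D_def)
    show "(\<Sum>p\<in>?X. if p \<in> A then sqrt k - \<epsilon> else k + sqrt k) \<le> real (span_pos (snd ` ?X)) + real P2"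
    proof (cases "l p0 = Suc (D p0 mod k)")
      case True
      have "p \<in> A" if "p \<in> ?X" for p
        using that lp[OF that] same[OF that] True by (simp add: A_def)
      then have "(\<Sum>p\<in>?X. if p \<in> A then sqrt k - \<epsilon> else k + sqrt k) = (\<Sum>p\<in>?X. sqrt k - \<epsilon>)"
        by (intro sum.cong) auto
      also have "\<dots> = (sqrt k - \<epsilon>) * card (snd ` ?X)" by (simp add: card)
      also have "\<dots> \<le> span_pos (snd ` ?X) + (real P2 - real (r2 + x2))"
      proof (rule card_le_span_pos[OF card_majority_window[OF P2(1,2)]])
        show "snd ` ?X \<subseteq> {t. t mod P2 div r2 = D p0 mod k \<or> k * r2 \<le> t mod P2}"
        proof
          fix t assume "t \<in> snd ` ?X"
          then obtain p where p: "p \<in> ?X" "t = snd p" by blast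
          show "t \<in> {t. t mod P2 div r2 = D p0 mod k \<or> k * r2 \<le> t mod P2}"
            using l2[OF p(1)] True p(2) by (auto simp: dirty_letter_def split: if_splits)
        qed
        \<comment> \<open>If \<open>x2 = sqrt k * r2\<close> held exactly, then
          \<open>P2 = sqrt k * (r2 + x2)\<close>. With rounding,
          \<open>(sqrt k - \<epsilon>) * x2 \<le> k * r2\<close> still holds.\<close>
        have "sqrt k * (x2 - sqrt k * r2) \<le> sqrt k * (\<epsilon> * r2)"
          using x2 by (intro mult_left_mono) auto
        moreover have "\<epsilon> * (sqrt k * r2) \<le> \<epsilon> * x2"
          using x2 \<open>\<epsilon> \<ge> 0\<close> by (intro mult_left_mono)
        moreover have "sqrt k * (sqrt k * r2) = k * r2"
          by (simp add: mult.assoc[symmetric])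
        moreover have "\<epsilon> * r2 \<ge> 0" using \<open>\<epsilon> \<ge> 0\<close> by simp
        ultimately have "sqrt k * x2 - k * r2 \<le> \<epsilon> * x2"
          by (simp add: algebra_simps)
        then show "(sqrt k - \<epsilon>) * real (r2 + x2) \<le> real P2"
          using P2 x2 \<open>\<epsilon> * r2 \<ge> 0\<close> by (simp add: algebra_simps)
        have "1 * r2 \<le> k * r2" using k by (intro mult_le_mono1) auto
        then show "r2 + x2 \<le> P2" using P2 by simp
      qed (use P2 k fin in auto)
      finally show ?thesis by simp
    next
      case False
      have "p \<notin> A" if "p \<in> ?X" for p
        using that lp[OF that] same[OF that] False by (simp add: A_def)
      then have "(\<Sum>p\<in>?X. if p \<in> A then sqrt k - \<epsilon> else k + sqrt k) = (\<Sum>p\<in>?X. k + sqrt k)"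
        by (intro sum.cong) auto
      also have "\<dots> = (k + sqrt k) * card (snd ` ?X)" by (simp add: card)
      also have "\<dots> \<le> span_pos (snd ` ?X) + (real P2 - real r2)"
      proof (rule card_le_span_pos[OF card_minority_window[OF P2(1,2)]])
        show "snd ` ?X \<subseteq> {t. t mod P2 div r2 = l p0 - 1}"
        proof
          fix t assume "t \<in> snd ` ?X"
          then obtain p where p: "p \<in> ?X" "t = snd p" by blast
          show "t \<in> {t. t mod P2 div r2 = l p0 - 1}"
            using l2[OF p(1)] False p(2) by (auto simp: dirty_letter_def split: if_splits)
        qed
        show "(k + sqrt k) * r2 \<le> real P2"
          using P2 x2 by (simp add: algebra_simps)
        have "1 * r2 \<le> k * r2" using k by (intro mult_le_mono1) auto
        then show "r2 \<le> P2" unfolding P2(1) by linarith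
      qed (use P2 k fin in auto)
      finally show ?thesis by simp
    qed
  qed (use M in auto)
  moreover have "(\<Sum>p\<in>M. if p \<in> A then sqrt k - \<epsilon> else k + sqrt k)
     = (\<Sum>p\<in>A. sqrt k - \<epsilon>) + (\<Sum>p\<in>M - A. k + sqrt k)"
  proof -
    have "M \<inter> {x. x \<in> A} = A" "M \<inter> - {x. x \<in> A} = M - A" using A by auto
    then show ?thesis using M(1) by (simp add: sum.If_cases)
  qed
  ultimately have 2: "(sqrt k - \<epsilon>) * card A + (k + sqrt k) * card (M - A)
      \<le> real (span_pos (snd ` M)) + real (v + u * Suc k) * real P2"
    by (simp add: mult.commute)
  have c: "real (card M) = card A + card (M - A)"
    using A M by (metis card_Diff_subset card_mono le_add_diff_inverse of_nat_add)
  have "real (span_pos (fst ` A)) \<le> span_pos (fst ` M)"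
    using A M by (intro of_nat_mono span_pos_mono) auto
  moreover have "0 \<le> \<epsilon> * card (M - A)" using \<open>\<epsilon> \<ge> 0\<close> by simp
  moreover have "(k + sqrt k - \<epsilon>) * card M = (real k * card A) +
      ((sqrt k - \<epsilon>) * card A + (k + sqrt k) * card (M - A)) - \<epsilon> * card (M - A)"
    unfolding c by (simp add: algebra_simps)
  ultimately show ?thesis using 1 2 unfolding R1_def by linarith
qed

section \<open>Translation between common subsequences and chains\<close>

lemma nths_eq_map_sorted_list_of_set:
  assumes "I \<subseteq> {..<length w}"
  shows "nths w I = map ((!) w) (sorted_list_of_set I)"
proof -
  have fin: "finite I" using assms finite_subset by blast
  have "sorted_wrt (<) (nths [0..<length w] I)"
    by (simp add: strict_sorted_iff sorted_nths)
  moreover have "set (nths [0..<length w] I) = set (sorted_list_of_set I)"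
    using assms fin by (force simp: set_nths)
  ultimately have "nths [0..<length w] I = sorted_list_of_set I"
    by (intro strict_sorted_equal) (simp_all add: strict_sorted_iff)
  then show ?thesis
    by (metis map_nth nths_map)
qed

text \<open>Positions of equal rank on the two sides are matched, by zipping the sorted position
  lists.\<close>

lemma strict_chain_of_common_subseq:
  assumes "common_subseq w1 w2 s"
  obtains M where "finite M" "strict_chain M" "fst ` M = fst s" "snd ` M = snd s"
    "\<And>p. p \<in> M \<Longrightarrow> w1 ! fst p = w2 ! snd p"
proof -
  define a b where "a = sorted_list_of_set (fst s)" and "b = sorted_list_of_set (snd s)"
  have s: "fst s \<subseteq> {..<length w1}" "snd s \<subseteq> {..<length w2}" "nths w1 (fst s) = nths w2 (snd s)"
    using assms by (auto simp: common_subseq_def)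
  have fin: "finite (fst s)" "finite (snd s)" using s finite_subset by blast+
  have map: "map ((!) w1) a = map ((!) w2) b"
    using s by (simp add: nths_eq_map_sorted_list_of_set a_def b_def)
  then have len: "length a = length b" by (metis length_map)
  have so: "sorted_wrt (<) a" "sorted_wrt (<) b" by (simp_all add: a_def b_def)
  show thesis
  proof
    show "finite (set (zip a b))" by simp
    have "fst ` set (zip a b) = set a" "snd ` set (zip a b) = set b"
      using len by (metis map_fst_zip set_map, metis map_snd_zip set_map)
    then show "fst ` set (zip a b) = fst s" "snd ` set (zip a b) = snd s"
      using fin by (simp_all add: a_def b_def)
    show "strict_chain (set (zip a b))"
      unfolding strict_chain_def
    proof (intro ballI impI)
      fix p q assume pq: "p \<in> set (zip a b)" "q \<in> set (zip a b)" "p \<noteq> q"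
      then obtain i j where ij: "i < length a" "j < length a" "p = (a!i, b!i)" "q = (a!j, b!j)"
        using len by (auto simp: in_set_zip)
      then have "i \<noteq> j" using pq by blast
      then show "fst p < fst q \<and> snd p < snd q \<or> fst q < fst p \<and> snd q < snd p"
        using ij so len by (auto simp: sorted_wrt_iff_nth_less neq_iff)
    qed
    fix p assume "p \<in> set (zip a b)"
    then obtain i where "i < length a" "p = (a!i, b!i)"
      using len by (auto simp: in_set_zip)
    then show "w1 ! fst p = w2 ! snd p"
      using map len by (metis fst_conv snd_conv nth_map)
  qed
qed

text \<open>A chain is the graph of a strictly increasing map \<open>h\<close>, which carries the
  sorted list of first coordinates to that of the second ones.\<close>

lemma common_subseq_of_strict_chain:
  assumes "finite M" "strict_chain M" "fst ` M \<subseteq> {..<length w1}" "snd ` M \<subseteq> {..<length w2}"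
    and eq: "\<And>p. p \<in> M \<Longrightarrow> w1 ! fst p = w2 ! snd p"
  shows "common_subseq w1 w2 (fst ` M, snd ` M)"
proof -
  define h where "h x = snd (the_inv_into M fst x)" for x
  have h: "h (fst p) = snd p" if "p \<in> M" for p
    using that strict_chain_inj_fst[OF assms(2)] by (simp add: h_def the_inv_into_f_f)
  let ?a = "sorted_list_of_set (fst ` M)"
  have set: "set ?a = fst ` M" using assms(1) by simp
  have hmono: "h x < h y" if xy: "x \<in> fst ` M" "y \<in> fst ` M" "x < y" for x y
  proof -
    obtain p q where pq: "p \<in> M" "q \<in> M" "x = fst p" "y = fst q" using xy by blast
    show ?thesis
      by (rule strict_chain_cases[OF assms(2) pq(1,2)]) (use xy pq h in auto)
  qed
  have "sorted_wrt (<) ?a" by simp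
  then have "sorted_wrt (<) (map h ?a)"
    unfolding sorted_wrt_map by (rule sorted_wrt_mono_rel[rotated]) (simp add: set hmono)
  moreover have "set (map h ?a) = set (sorted_list_of_set (snd ` M))"
    using assms(1) h by (simp add: image_image)
  ultimately have "map h ?a = sorted_list_of_set (snd ` M)"
    by (intro strict_sorted_equal) simp_all
  moreover have "map ((!) w1) ?a = map ((!) w2) (map h ?a)"
    using set h eq by (auto simp del: set_sorted_list_of_set)
  ultimately show ?thesis
    using assms by (simp add: common_subseq_def nths_eq_map_sorted_list_of_set)
qed

section \<open>Attainment of the maxima defining \<open>LCS\<close> and
  \<open>LCS_code\<close>\<close>

lemma finite_common_subseq: "finite {s. common_subseq w1 w2 s}"
  by (rule finite_subset[of _ "Pow {..<length w1} \<times> Pow {..<length w2}"])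
    (auto simp: common_subseq_def)

lemma len_cs_le_LCS: "common_subseq w1 w2 s \<Longrightarrow> len_cs s \<le> LCS w1 w2"
  unfolding LCS_def using finite_common_subseq[of w1 w2] by (intro Max_ge) auto

lemma LCS_attained: obtains s where "common_subseq w1 w2 s" "LCS w1 w2 = len_cs s"
proof -
  have "common_subseq w1 w2 ({}, {})" by (simp add: common_subseq_def)
  then have "LCS w1 w2 \<in> len_cs ` {s. common_subseq w1 w2 s}"
    unfolding LCS_def using finite_common_subseq[of w1 w2] by (intro Max_in) auto
  then show thesis using that by blast
qed

lemma LCS_le_length: "LCS w1 w2 \<le> length w1"
proof -
  obtain s where s: "common_subseq w1 w2 s" "LCS w1 w2 = len_cs s" by (rule LCS_attained)
  then have "card (fst s) \<le> card {..<length w1}"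
    by (intro card_mono) (auto simp: common_subseq_def)
  then show ?thesis using s by (simp add: len_cs_def)
qed

lemma finite_LCS_pairs:
  assumes "finite C"
  shows "finite {LCS c1 c2 | c1 c2. c1 \<in> C \<and> c2 \<in> C \<and> c1 \<noteq> c2}"
  by (rule finite_subset[of _ "(\<lambda>(a, b). LCS a b) ` (C \<times> C)"]) (use assms in auto)

lemma LCS_le_LCS_code:
  assumes "finite C" "c1 \<in> C" "c2 \<in> C" "c1 \<noteq> c2"
  shows "LCS c1 c2 \<le> LCS_code C"
  unfolding LCS_code_def using assms by (intro Max_ge finite_LCS_pairs) auto

lemma LCS_code_attained:
  assumes "card C \<ge> 2"
  obtains c1 c2 where "c1 \<in> C" "c2 \<in> C" "c1 \<noteq> c2" "LCS_code C = LCS c1 c2"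
proof -
  have fin: "finite C" using assms by (metis card.infinite not_numeral_le_zero)
  have "\<exists>c1\<in>C. \<exists>c2\<in>C. c1 \<noteq> c2"
    using assms card_le_Suc0_iff_eq[OF fin] by (auto simp: not_le Suc_le_eq)
  then have "LCS_code C \<in> {LCS c1 c2 | c1 c2. c1 \<in> C \<and> c2 \<in> C \<and> c1 \<noteq> c2}"
    unfolding LCS_code_def using fin by (intro Max_in finite_LCS_pairs) auto
  then show thesis using that by blast
qed

section \<open>Concatenated codewords and their blocks\<close>

lemma length_encode:
  assumes "\<And>a. a \<in> set c \<Longrightarrow> length (\<tau> a) = T"
  shows "length (encode \<tau> c) = length c * T"
  using assms by (induction c) (auto simp: encode_def)

lemma encode_nth:
  assumes "\<And>a. a \<in> set c \<Longrightarrow> length (\<tau> a) = T" "x < length c * T"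
  shows "encode \<tau> c ! x = \<tau> (c ! (x div T)) ! (x mod T)"
  using assms
proof (induction c arbitrary: x)
  case (Cons a c)
  then have T: "length (\<tau> a) = T" by simp
  show ?case
  proof (cases "x < T")
    case True
    then show ?thesis using T by (simp add: encode_def nth_append)
  next
    case False
    then have "encode \<tau> (a # c) ! x = encode \<tau> c ! (x - T)"
      using T by (simp add: encode_def nth_append)
    also have "\<dots> = \<tau> (c ! ((x - T) div T)) ! ((x - T) mod T)"
      using Cons.prems False by (intro Cons.IH) auto
    finally show ?thesis
      using False Cons.prems(2) by (cases "T = 0") (simp_all add: le_div_geq le_mod_geq)
  qed
qed simp

text \<open>Images of equal length can be decoded one after the other from the left.\<close>

lemma inj_on_encode:
  assumes "\<And>a. a \<in> A \<Longrightarrow> length (\<tau> a) = T" "inj_on \<tau> A"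
    and "\<And>c. c \<in> C \<Longrightarrow> length c = n \<and> set c \<subseteq> A"
  shows "inj_on (encode \<tau>) C"
proof -
  have "c = d" if "length c = length d" "set c \<subseteq> A" "set d \<subseteq> A" "encode \<tau> c = encode \<tau> d" for c d
    using that
  proof (induction c d rule: list_induct2)
    case (Cons a c b d)
    then have "length (\<tau> a) = length (\<tau> b)" using assms(1) by simp
    then show ?case using Cons inj_onD[OF assms(2), of a b] by (simp add: encode_def)
  qed simp
  then show ?thesis using assms(3) by (auto intro!: inj_onI)
qed

text \<open>A greedy step picks the first block pair \<open>(i, j)\<close>: the pairs that meet row \<open>i\<close> or column \<open>j\<close>
  all lie in that row or all in that column, so at most \<open>T\<close> of them are discarded.\<close>

lemma coarse_strict_chain:
  fixes T :: nat
  assumes "finite M" "strict_chain M" "T > 0"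
  shows "\<exists>S \<subseteq> (\<lambda>p. (fst p div T, snd p div T)) ` M. strict_chain S \<and> card M \<le> T * card S"
  using assms(1,2)
proof (induction "card M" arbitrary: M rule: less_induct)
  case less
  show ?case
  proof (cases "M = {}")
    case True
    then show ?thesis by (intro exI[of _ "{}"]) (simp add: strict_chain_def)
  next
    case False
    let ?b = "\<lambda>p. (fst p div T, snd p div T)"
    obtain p0 where p0: "p0 \<in> M" "\<And>p. p \<in> M \<Longrightarrow> fst p0 \<le> fst p"
      using ex_min_if_finite[of "fst ` M"] less.prems False
      by (metis (no_types, lifting) arg_min_if_finite linorder_not_less)
    have p0': "fst p0 div T \<le> fst p div T \<and> snd p0 div T \<le> snd p div T" if "p \<in> M" for p
      by (rule strict_chain_cases[OF less.prems(2) p0(1) that])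
        (use p0(2)[OF that] in \<open>auto intro: div_le_mono\<close>)
    define M1 where "M1 = {p\<in>M. fst p div T = fst p0 div T \<or> snd p div T = snd p0 div T}"
    define M2 where "M2 = M - M1"
    have "card M2 < card M"
      using p0 less.prems by (intro psubset_card_mono) (auto simp: M2_def M1_def)
    moreover have "finite M2" "strict_chain M2"
      using less.prems strict_chain_subset[of M M2] by (auto simp: M2_def)
    ultimately obtain S where S: "S \<subseteq> ?b ` M2" "strict_chain S" "card M2 \<le> T * card S"
      using less.hyps by blast
    \<comment> \<open>Whatever survives lies strictly beyond the chosen block pair in both
      coordinates, so that pair extends the chain \<open>S\<close>.\<close>
    have gt: "fst p0 div T < fst q \<and> snd p0 div T < snd q" if q: "q \<in> S" for q
    proof -
      obtain p where p: "p \<in> M2" "q = ?b p" using S q by blast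
      then show ?thesis using p0'[of p] by (auto simp: M2_def M1_def)
    qed
    have block: "card {x::nat. x div T = i} = T \<and> finite {x. x div T = i}" for i
    proof -
      have "{x. x div T = i} = {i * T..<i * T + T}" using div_eq_interval[OF \<open>T > 0\<close>] by blast
      then show ?thesis by simp
    qed
    have "card M1 \<le> T"
    proof (cases "\<exists>p\<in>M. fst p div T = fst p0 div T \<and> snd p0 div T < snd p div T")
      case True
      then obtain p where p: "p \<in> M" "fst p div T = fst p0 div T" "snd p0 div T < snd p div T"
        by blast
      \<comment> \<open>A pair of that column outside the row would have a later row but an earlier
        column than \<open>p\<close>, so the two would cross.\<close>
      have "fst q div T = fst p0 div T" if q: "q \<in> M1" for q
      proof (rule ccontr)
        assume ne: "fst q div T \<noteq> fst p0 div T"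
        then have qM: "q \<in> M" "snd q div T = snd p0 div T" using q by (auto simp: M1_def)
        then have "fst p div T < fst q div T" using ne p0'[of q] p by simp
        moreover have "snd q div T < snd p div T" using qM p by simp
        ultimately show False
          using div_le_mono[of "fst q" "fst p" T] div_le_mono[of "snd p" "snd q" T]
          by (cases rule: strict_chain_cases[OF less.prems(2) p(1) qM(1)]) auto
      qed
      then have "fst ` M1 \<subseteq> {x. x div T = fst p0 div T}" by auto
      moreover have "inj_on fst M1"
        using strict_chain_inj_fst[OF less.prems(2)] by (rule inj_on_subset) (auto simp: M1_def)
      ultimately show ?thesis using block card_inj_on_le by metis
    next
      case False
      then have "snd q div T = snd p0 div T" if "q \<in> M1" for q
        using that p0'[of q] by (auto simp: M1_def)
      then have "snd ` M1 \<subseteq> {x. x div T = snd p0 div T}" by auto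
      moreover have "inj_on snd M1"
        using strict_chain_inj_snd[OF less.prems(2)] by (rule inj_on_subset) (auto simp: M1_def)
      ultimately show ?thesis using block card_inj_on_le by metis
    qed
    moreover have "card M = card M1 + card M2"
    proof -
      have "M = M1 \<union> M2" "M1 \<inter> M2 = {}" by (auto simp: M1_def M2_def)
      then show ?thesis using less.prems by (metis card_Un_disjoint finite_Un)
    qed
    moreover have "card (insert (?b p0) S) = Suc (card S)"
    proof (rule card_insert_disjoint)
      show "finite S" using S \<open>finite M2\<close> finite_surj by blast
      show "?b p0 \<notin> S" using gt by fastforce
    qed
    ultimately have "card M \<le> T * card (insert (?b p0) S)" using S by simp
    moreover have "strict_chain (insert (?b p0) S)"
      using S(2) gt unfolding strict_chain_def by auto
    moreover have "insert (?b p0) S \<subseteq> ?b ` M"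
      using S(1) p0(1) by (auto simp: M2_def)
    ultimately show ?thesis by blast
  qed
qed

text \<open>Lifts a bound between inner words to codewords; \<open>inner\<close> is all that is used
  about matching different images. Its error \<open>\<delta>\<close> is paid at most
  \<open>2 * n\<close> times.\<close>

lemma span_encode:
  fixes \<beta> \<delta> :: real
  assumes "T > 0" "\<beta> \<ge> 0" "\<delta> \<ge> 0"
    and len: "\<And>a. a \<in> A \<Longrightarrow> length (\<tau> a) = T"
    and inner: "\<And>a b M. a \<in> A \<Longrightarrow> b \<in> A \<Longrightarrow> a \<noteq> b \<Longrightarrow> finite M \<Longrightarrow> strict_chain M \<Longrightarrow>
      fst ` M \<subseteq> {..<T} \<Longrightarrow> snd ` M \<subseteq> {..<T} \<Longrightarrow> (\<And>p. p \<in> M \<Longrightarrow> \<tau> a ! fst p = \<tau> b ! snd p) \<Longrightarrow>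
      \<beta> * card M \<le> real (span_pos (fst ` M)) + real (span_pos (snd ` M)) + \<delta>"
    and c: "length c = n" "set c \<subseteq> A" and d: "length d = n" "set d \<subseteq> A"
    and s: "common_subseq (encode \<tau> c) (encode \<tau> d) s"
  shows "\<beta> * len_cs s \<le> real (span_cs s) + real (2 * n) * \<delta> + \<beta> * real (T * LCS c d)"
proof -
  obtain M where M: "finite M" "strict_chain M" "fst ` M = fst s" "snd ` M = snd s"
    and eq: "\<And>p. p \<in> M \<Longrightarrow> encode \<tau> c ! fst p = encode \<tau> d ! snd p"
    using strict_chain_of_common_subseq[OF s] by metis
  have lenc: "\<And>a. a \<in> set c \<Longrightarrow> length (\<tau> a) = T" and lend: "\<And>a. a \<in> set d \<Longrightarrow> length (\<tau> a) = T"
    using len c d by auto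
  have cM: "card M = len_cs s"
    using card_image[OF strict_chain_inj_fst[OF M(2)]] M(3) by (simp add: len_cs_def)
  have bnd: "fst p < n * T" "snd p < n * T" if "p \<in> M" for p
    using that s M length_encode[of c \<tau> T, OF lenc] length_encode[of d \<tau> T, OF lend] c d
    by (auto simp: common_subseq_def)
  have blk: "fst p div T < n" "snd p div T < n" if "p \<in> M" for p
    using bnd[OF that] by (simp_all add: less_mult_imp_div_less)
  have letter: "\<tau> (c ! (fst p div T)) ! (fst p mod T) = \<tau> (d ! (snd p div T)) ! (snd p mod T)"
    if "p \<in> M" for p
    using eq[OF that] encode_nth[of c \<tau> T, OF lenc] encode_nth[of d \<tau> T, OF lend] bnd[OF that] c d
    by simp
  define B where "B = {p\<in>M. c ! (fst p div T) = d ! (snd p div T)}"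
  define G where "G = M - B"
  have BM: "B \<subseteq> M" "finite B" and GM: "G \<subseteq> M" "finite G" using M by (auto simp: B_def G_def)

  \<comment> \<open>Block pairs of equal letters that form a chain are a common subsequence of
    \<open>c\<close> and \<open>d\<close>.\<close>
  have "card B \<le> T * LCS c d"
  proof -
    obtain S where S: "S \<subseteq> (\<lambda>p. (fst p div T, snd p div T)) ` B" "strict_chain S" "card B \<le> T * card S"
      using coarse_strict_chain[OF BM(2) strict_chain_subset[OF M(2) BM(1)] \<open>T > 0\<close>] by blast
    have Sp: "fst q < n \<and> snd q < n \<and> c ! fst q = d ! snd q" if q: "q \<in> S" for q
    proof -
      obtain p where "p \<in> B" "q = (fst p div T, snd p div T)" using q S by blast
      then show ?thesis using blk[of p] by (auto simp: B_def)
    qed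
    have "common_subseq c d (fst ` S, snd ` S)"
      using S BM Sp c d by (intro common_subseq_of_strict_chain) (auto intro: finite_surj)
    then have "len_cs (fst ` S, snd ` S) \<le> LCS c d" by (rule len_cs_le_LCS)
    then have "card S \<le> LCS c d"
      using card_image[OF strict_chain_inj_fst[OF S(2)]] by (simp add: len_cs_def)
    then show ?thesis using S(3) by (meson le_trans mult_le_mono2)
  qed
  then have cB: "\<beta> * card B \<le> \<beta> * real (T * LCS c d)"
    using \<open>\<beta> \<ge> 0\<close> by (intro mult_left_mono of_nat_mono)

  \<comment> \<open>Both block indices are monotone along the chain, so their sum determines the
    block pair, and it stays below \<open>2 * n\<close>.\<close>
  define key where "key p = fst p div T + snd p div T" for p :: "nat \<times> nat"
  have mono: "fst p div T \<le> fst q div T \<and> snd p div T \<le> snd q div T"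
    if "p \<in> G" "q \<in> G" "fst p \<le> fst q \<or> snd p \<le> snd q" for p q
  proof -
    have "p \<in> M" "q \<in> M" using that GM by auto
    then show ?thesis
      by (rule strict_chain_cases[OF M(2)]) (use that in \<open>auto intro: div_le_mono\<close>)
  qed
  have piece: "\<beta> * card {p\<in>G. key p = e} \<le> real (span_pos (fst ` {p\<in>G. key p = e})) +
      real (span_pos (snd ` {p\<in>G. key p = e})) + \<delta>" if e: "e \<in> key ` G" for e
  proof -
    let ?X = "{p\<in>G. key p = e}"
    obtain p0 where p0: "p0 \<in> G" "key p0 = e" using e by blast
    define i j where "i = fst p0 div T" and "j = snd p0 div T"
    have ij: "fst p div T = i \<and> snd p div T = j" if "p \<in> ?X" for p
      using that p0 mono[of p p0] mono[of p0 p] unfolding key_def i_def j_def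
      by (cases "fst p \<le> fst p0") auto
    \<comment> \<open>Passes to coordinates inside the two blocks; on one piece this is a
      translation, so spans are unchanged.\<close>
    define \<sigma> where "\<sigma> p = (fst p mod T, snd p mod T)" for p :: "nat \<times> nat"
    have dec: "fst p = i * T + fst (\<sigma> p)" "snd p = j * T + snd (\<sigma> p)" if "p \<in> ?X" for p
      using ij[OF that] div_mult_mod_eq[of "fst p" T] div_mult_mod_eq[of "snd p" T]
      by (simp_all add: \<sigma>_def)
    have inj: "inj_on \<sigma> ?X"
      by (rule inj_onI) (metis dec prod_eqI)
    have fX: "fst ` ?X = (\<lambda>x. i * T + x) ` fst ` \<sigma> ` ?X" "snd ` ?X = (\<lambda>x. j * T + x) ` snd ` \<sigma> ` ?X"
      unfolding image_image using dec by (intro image_cong refl; blast)+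
    have "\<beta> * card (\<sigma> ` ?X) \<le> real (span_pos (fst ` \<sigma> ` ?X)) + real (span_pos (snd ` \<sigma> ` ?X)) + \<delta>"
    proof (rule inner)
      have p0M: "p0 \<in> M" using p0 GM by auto
      show "c ! i \<in> A" "d ! j \<in> A"
        using blk[OF p0M] c d by (auto simp: i_def j_def)
      show "c ! i \<noteq> d ! j"
        using p0 by (auto simp: G_def B_def i_def j_def)
      show "finite (\<sigma> ` ?X)" using GM by simp
      show "strict_chain (\<sigma> ` ?X)"
        unfolding strict_chain_def
      proof (intro ballI impI)
        fix p' q' assume "p' \<in> \<sigma> ` ?X" "q' \<in> \<sigma> ` ?X" "p' \<noteq> q'"
        then obtain p q where pq: "p \<in> ?X" "q \<in> ?X" "p' = \<sigma> p" "q' = \<sigma> q" "p \<noteq> q" by blast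
        then have "p \<in> M" "q \<in> M" using GM by auto
        then show "fst p' < fst q' \<and> snd p' < snd q' \<or> fst q' < fst p' \<and> snd q' < snd p'"
          by (rule strict_chain_cases[OF M(2)]) (use pq dec[of p] dec[of q] in auto)
      qed
      show "fst ` \<sigma> ` ?X \<subseteq> {..<T}" "snd ` \<sigma> ` ?X \<subseteq> {..<T}"
        using \<open>T > 0\<close> by (auto simp: \<sigma>_def)
      fix q assume "q \<in> \<sigma> ` ?X"
      then obtain p where p: "p \<in> ?X" "q = \<sigma> p" by blast
      then show "\<tau> (c ! i) ! fst q = \<tau> (d ! j) ! snd q"
        using letter[of p] ij[OF p(1)] GM by (auto simp: \<sigma>_def)
    qed
    then show ?thesis
      unfolding fX using card_image[OF inj] GM by (simp add: span_pos_shift)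
  qed
  have "real (card G) = (\<Sum>e\<in>key ` G. real (card {p\<in>G. key p = e}))"
    using sum.image_gen[OF GM(2), of "\<lambda>_. 1::real" key] by simp
  then have "\<beta> * card G = (\<Sum>e\<in>key ` G. \<beta> * card {p\<in>G. key p = e})"
    by (simp add: sum_distrib_left)
  also have "\<dots> \<le> (\<Sum>e\<in>key ` G. real (span_pos (fst ` {p\<in>G. key p = e})) +
      real (span_pos (snd ` {p\<in>G. key p = e})) + \<delta>)"
    by (rule sum_mono) (rule piece)
  also have "\<dots> = real (\<Sum>e\<in>key ` G. span_pos (fst ` {p\<in>G. key p = e})) +
      real (\<Sum>e\<in>key ` G. span_pos (snd ` {p\<in>G. key p = e})) + card (key ` G) * \<delta>"
    by (simp add: sum.distrib)
  also have "\<dots> \<le> real (span_pos (fst ` M)) + real (span_pos (snd ` M)) + (2 * n) * \<delta>"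
  proof (intro add_mono mult_right_mono of_nat_mono \<open>\<delta> \<ge> 0\<close>)
    have "(\<Sum>e\<in>key ` G. span_pos (fst ` {p\<in>G. key p = e})) \<le> span_pos (fst ` G)"
      using GM(2) mono by (intro sum_span_pos_le) (auto simp: key_def intro!: add_mono)
    then show "(\<Sum>e\<in>key ` G. span_pos (fst ` {p\<in>G. key p = e})) \<le> span_pos (fst ` M)"
      using span_pos_mono[of "fst ` M" "fst ` G"] M GM by (meson finite_imageI image_mono le_trans)
    have "(\<Sum>e\<in>key ` G. span_pos (snd ` {p\<in>G. key p = e})) \<le> span_pos (snd ` G)"
      using GM(2) mono by (intro sum_span_pos_le) (auto simp: key_def intro!: add_mono)
    then show "(\<Sum>e\<in>key ` G. span_pos (snd ` {p\<in>G. key p = e})) \<le> span_pos (snd ` M)"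
      using span_pos_mono[of "snd ` M" "snd ` G"] M GM by (meson finite_imageI image_mono le_trans)
    have "key p < 2 * n" if "p \<in> G" for p
      using blk[of p] that GM by (auto simp: key_def)
    then have "key ` G \<subseteq> {..<2 * n}" by auto
    then show "card (key ` G) \<le> 2 * n" using card_mono[of "{..<2 * n}"] by fastforce
  qed
  finally have cG: "\<beta> * card G \<le> real (span_cs s) + real (2 * n) * \<delta>"
    using M by (simp add: span_cs_def)
  have "real (card M) = card B + card G"
    using BM M(1) unfolding G_def by (metis card_Diff_subset card_mono le_add_diff_inverse of_nat_add)
  then show ?thesis using cB cG cM by (simp add: algebra_simps)
qed

section \<open>The inner words and the choice of scales\<close>

text \<open>Here \<open>r = \<rho> ^ (K - a + 1)\<close>, \<open>x = y * \<rho> ^ (K - a)\<close>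
  and, for \<open>a \<le> K\<close>, \<open>R = (k * \<rho> + y) * \<rho> ^ (K + a)\<close>, so the
  common length holds \<open>\<rho> ^ (K + a)\<close> periods and \<open>\<rho> ^ (K - a)\<close>
  stretches. The extra factor \<open>\<rho>\<close> in \<open>r\<close> lets an integer
  \<open>y\<close> approximate \<open>sqrt k * \<rho>\<close> well.\<close>

definition inner_word :: "nat \<Rightarrow> nat \<Rightarrow> nat \<Rightarrow> nat \<Rightarrow> nat \<Rightarrow> nat list" where
  "inner_word K k \<rho> y a =
     map (dirty_letter k (\<rho> * \<rho> ^ (K - a)) ((k * \<rho> + y) * \<rho> ^ (K - a)) ((k * \<rho> + y) * \<rho> ^ (K - a) * \<rho> ^ (2 * a)))
       [0..<(k * \<rho> + y) * \<rho> ^ (2 * K)]"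

lemma inner_word_in_words:
  assumes "k > 0"
  shows "inner_word K k \<rho> y a \<in> words k ((k * \<rho> + y) * \<rho> ^ (2 * K))"
  using dirty_letter_bounds[OF assms] by (auto simp: inner_word_def words_def)

text \<open>For \<open>a < b\<close> the words differ at position \<open>r b\<close>: the first run
  of the coarser word has not ended there, whereas that of the finer one just has.\<close>

lemma inj_on_inner_word:
  assumes "k \<ge> 2" "\<rho> \<ge> 2"
  shows "inj_on (inner_word K k \<rho> y) {1..K}"
proof (rule linorder_inj_onI')
  fix a b assume ab: "a \<in> {1..K}" "b \<in> {1..K}" "a < b"
  define r where "r c = \<rho> * \<rho> ^ (K - c)" for c
  define P where "P c = (k * \<rho> + y) * \<rho> ^ (K - c)" for c
  have P: "P c = k * r c + y * \<rho> ^ (K - c)" for c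
    by (simp add: P_def r_def algebra_simps)
  have r0: "r c > 0" for c using assms by (simp add: r_def)
  have "\<rho> ^ (K - b) < \<rho> ^ (K - a)"
    using ab assms by (intro power_strict_increasing) auto
  then have rab: "r b < r a" using assms by (simp add: r_def)
  have kr: "r c < k * r c" "r c < P c" for c
  proof -
    have "2 * r c \<le> k * r c" using assms by (intro mult_le_mono1)
    then show "r c < k * r c" using r0[of c] by linarith
    then show "r c < P c" using P[of c] by linarith
  qed
  have "r b \<le> \<rho> ^ (2 * K)"
    unfolding r_def power_Suc[symmetric] using ab assms by (intro power_increasing) auto
  also have "\<dots> \<le> \<rho> * \<rho> ^ (2 * K)" using assms by simp
  also have "\<dots> < k * (\<rho> * \<rho> ^ (2 * K))" using assms by simp
  also have "\<dots> \<le> (k * \<rho> + y) * \<rho> ^ (2 * K)" by (simp add: algebra_simps)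
  finally have rT: "r b < (k * \<rho> + y) * \<rho> ^ (2 * K)" .
  have "inner_word K k \<rho> y a ! r b = 1"
    using rT rab kr[of a] order.strict_trans[OF rab kr(1)] by (simp add: inner_word_def dirty_letter_def r_def[symmetric] P_def[symmetric])
  moreover have "inner_word K k \<rho> y b ! r b = 2"
    using rT r0[of b] kr[of b] by (simp add: inner_word_def dirty_letter_def r_def[symmetric] P_def[symmetric])
  ultimately show "inner_word K k \<rho> y a \<noteq> inner_word K k \<rho> y b" by auto
qed

text \<open>Scale separation makes every error a multiple of \<open>T / \<rho>\<close>:
  \<open>k - 1\<close> for incomplete cycles of the coarser word, \<open>1\<close> for stretch
  boundaries, \<open>k + 1\<close> for run boundaries and \<open>1\<close> for rounding.\<close>

lemma span_inner_words_less:
  fixes k \<rho> y K a b :: nat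
  defines "T \<equiv> (k * \<rho> + y) * \<rho> ^ (2 * K)"
  assumes "k \<ge> 2" "\<rho> \<ge> 1" and y: "sqrt k * \<rho> \<le> y" "y \<le> sqrt k * \<rho> + 1"
    and ab: "1 \<le> a" "a < b" "b \<le> K"
    and M: "finite M" "strict_chain M" "fst ` M \<subseteq> {..<T}" "snd ` M \<subseteq> {..<T}"
    and eq: "\<And>p. p \<in> M \<Longrightarrow> inner_word K k \<rho> y a ! fst p = inner_word K k \<rho> y b ! snd p"
  shows "(k + sqrt k) * card M \<le> real (span_pos (fst ` M)) + real (span_pos (snd ` M))
     + (2 * k + 2) * T / \<rho>"
proof -
  define Q where "Q = k * \<rho> + y"
  have \<rho>: "\<rho> > 0" "real \<rho> > 0" using assms by auto
  \<comment> \<open>The coarser word, that of \<open>a\<close>, comes first, with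
    \<open>\<rho> ^ (K + a)\<close> periods; that of \<open>b\<close> has
    \<open>\<rho> ^ (K - b)\<close> stretches. Rounding moves \<open>y / \<rho>\<close> by at most
    \<open>1 / \<rho>\<close>, which is the choice of \<open>\<epsilon>\<close>.\<close>
  have main: "(k + sqrt k - 1 / \<rho>) * card M \<le> real (span_pos (fst ` M)) + real (span_pos (snd ` M))
     + \<rho> ^ (K - b) * ((real k - 1) * (Q * \<rho> ^ (K - a) * \<rho> ^ (2 * a)))
     + real (\<rho> ^ (K - b) + \<rho> ^ (K + a) * Suc k) * real (Q * \<rho> ^ (K - b))"
  proof (rule span_dirty_words[of k _ "\<rho> * \<rho> ^ (K - a)" "y * \<rho> ^ (K - a)" _ _ "\<rho> * \<rho> ^ (K - b)" "y * \<rho> ^ (K - b)"])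
    show "Q * \<rho> ^ (K - a) = k * (\<rho> * \<rho> ^ (K - a)) + y * \<rho> ^ (K - a)"
      "Q * \<rho> ^ (K - b) = k * (\<rho> * \<rho> ^ (K - b)) + y * \<rho> ^ (K - b)"
      by (simp_all add: Q_def algebra_simps)
    show "sqrt k * real (\<rho> * \<rho> ^ (K - b)) \<le> real (y * \<rho> ^ (K - b))"
      using y(1) \<rho> mult_right_mono[of "sqrt k * \<rho>" y "real (\<rho> ^ (K - b))"] by (simp add: mult.assoc)
    show "real (y * \<rho> ^ (K - b)) \<le> sqrt k * real (\<rho> * \<rho> ^ (K - b)) + 1 / \<rho> * real (\<rho> * \<rho> ^ (K - b))"
      using y(2) \<rho> mult_right_mono[of y "sqrt k * \<rho> + 1" "real (\<rho> ^ (K - b))"]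
      by (simp add: algebra_simps)
    show "T = Q * \<rho> ^ (K - a) * \<rho> ^ (K + a)"
      using ab by (simp add: T_def Q_def mult.assoc power_add[symmetric] mult_2)
    show "T = Q * \<rho> ^ (K - b) * \<rho> ^ (2 * b) * \<rho> ^ (K - b)"
      using ab by (simp add: T_def Q_def mult.assoc power_add[symmetric] mult_2)
    fix p assume p: "p \<in> M"
    then have "fst p < T" "snd p < T" using M by auto
    then show "dirty_letter k (\<rho> * \<rho> ^ (K - a)) (Q * \<rho> ^ (K - a)) (Q * \<rho> ^ (K - a) * \<rho> ^ (2 * a)) (fst p) =
         dirty_letter k (\<rho> * \<rho> ^ (K - b)) (Q * \<rho> ^ (K - b)) (Q * \<rho> ^ (K - b) * \<rho> ^ (2 * b)) (snd p)"
      using eq[OF p] by (simp add: inner_word_def T_def Q_def)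
  qed (use assms \<rho> in auto)
  \<comment> \<open>An exponent below \<open>2 * K\<close> leaves a factor \<open>\<rho>\<close> to
    spare. It comes from \<open>a < b\<close> for cycles and runs, and from \<open>b\<close> being
    positive for the stretch boundaries.\<close>
  have pw: "real (Q * \<rho> ^ e) \<le> T / \<rho>" if "Suc e \<le> 2 * K" for e
  proof -
    have "Q * \<rho> ^ Suc e \<le> Q * \<rho> ^ (2 * K)"
      using \<rho> that by (intro mult_le_mono2 power_increasing) auto
    then have "real (Q * \<rho> ^ e) * \<rho> \<le> T"
      unfolding T_def Q_def[symmetric] by (metis mult.assoc mult.commute of_nat_le_iff of_nat_mult power_Suc)
    then show ?thesis using \<rho> by (simp add: pos_le_divide_eq)
  qed
  have e1: "\<rho> ^ (K - b) * ((real k - 1) * (Q * \<rho> ^ (K - a) * \<rho> ^ (2 * a))) \<le> (real k - 1) * (T / \<rho>)"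
  proof -
    have "\<rho> ^ (K - b) * ((real k - 1) * (Q * \<rho> ^ (K - a) * \<rho> ^ (2 * a)))
       = (real k - 1) * real (Q * \<rho> ^ (K - b + (K - a) + 2 * a))"
      by (simp add: power_add)
    also have "\<dots> \<le> (real k - 1) * (T / \<rho>)"
      using assms by (intro mult_left_mono pw) auto
    finally show ?thesis .
  qed
  have e2: "real (\<rho> ^ (K - b) + \<rho> ^ (K + a) * Suc k) * real (Q * \<rho> ^ (K - b)) \<le> T / \<rho> + Suc k * (T / \<rho>)"
  proof -
    have "real (\<rho> ^ (K - b) + \<rho> ^ (K + a) * Suc k) * real (Q * \<rho> ^ (K - b))
       = real (Q * \<rho> ^ (K - b + (K - b))) + Suc k * real (Q * \<rho> ^ (K + a + (K - b)))"
      by (simp add: power_add algebra_simps)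
    also have "\<dots> \<le> T / \<rho> + Suc k * (T / \<rho>)"
      using ab by (intro add_mono mult_left_mono pw) auto
    finally show ?thesis .
  qed
  have "card M = card (fst ` M)" using card_image[OF strict_chain_inj_fst[OF M(2)]] by simp
  also have "\<dots> \<le> T" using card_mono[OF _ M(3)] by simp
  finally have e3: "1 / \<rho> * card M \<le> T / \<rho>"
    using \<rho> by (simp add: divide_right_mono)
  have "(2 * k + 2) * T / \<rho> = (real k - 1) * (T / \<rho>) + (T / \<rho> + Suc k * (T / \<rho>)) + T / \<rho>"
    by (simp add: divide_inverse algebra_simps)
  then show ?thesis using main e1 e2 e3 by (simp add: left_diff_distrib)
qed

text \<open>The bound is symmetric in the two words, so exchanging the coordinates of
  \<open>M\<close> reduces to \<open>a < b\<close>.\<close>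

lemma span_inner_words:
  fixes k \<rho> y K a b :: nat
  defines "T \<equiv> (k * \<rho> + y) * \<rho> ^ (2 * K)"
  assumes A: "k \<ge> 2" "\<rho> \<ge> 1" "sqrt k * \<rho> \<le> y" "y \<le> sqrt k * \<rho> + 1"
    and ab: "a \<in> {1..K}" "b \<in> {1..K}" "a \<noteq> b"
    and M: "finite M" "strict_chain M" "fst ` M \<subseteq> {..<T}" "snd ` M \<subseteq> {..<T}"
    and eq: "\<And>p. p \<in> M \<Longrightarrow> inner_word K k \<rho> y a ! fst p = inner_word K k \<rho> y b ! snd p"
  shows "(k + sqrt k) * card M \<le> real (span_pos (fst ` M)) + real (span_pos (snd ` M))
     + (2 * k + 2) * T / \<rho>"
proof (cases "a < b")
  case True
  then show ?thesis
    using ab M eq unfolding T_def by (intro span_inner_words_less[OF A, where a = a and b = b]) auto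
next
  case False
  have img: "fst ` prod.swap ` M = snd ` M" "snd ` prod.swap ` M = fst ` M"
    by (simp_all add: image_image)
  have "strict_chain (prod.swap ` M)"
    using M(2) unfolding strict_chain_def by auto
  then have "(k + sqrt k) * card (prod.swap ` M) \<le> real (span_pos (fst ` prod.swap ` M))
      + real (span_pos (snd ` prod.swap ` M)) + (2 * k + 2) * T / \<rho>"
    using False ab M eq unfolding T_def
    by (intro span_inner_words_less[OF A, where a = b and b = a]) (auto simp: img)
  moreover have "card (prod.swap ` M) = card M"
    by (intro card_image) (auto simp: inj_on_def)
  ultimately show ?thesis unfolding img by simp
qed

lemma nat_ceiling_le_add_one:
  fixes z :: real
  assumes "z \<ge> 0"
  shows "real (nat \<lceil>z\<rceil>) \<le> z + 1"
  using assms of_int_ceiling_le_add_one[of z] by simp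

section \<open>Error accounting and conclusion\<close>

text \<open>The constant is \<open>5 = 3 + 2\<close>: \<open>2 * n\<close> pieces between different
  letters cost \<open>3 / 2 * \<gamma> * k * T\<close> each, and the pairs between equal letters
  cost at most \<open>2 * k\<close> each, by \<open>sqrt k \<le> k\<close>.\<close>

lemma span_encode_inner_word:
  fixes K k n \<rho> y :: nat and \<gamma> :: real
  defines "T \<equiv> (k * \<rho> + y) * \<rho> ^ (2 * K)"
  assumes k: "k \<ge> 2" and "\<gamma> > 0" and \<rho>: "\<rho> \<ge> 2" "k / \<gamma> \<le> \<rho>"
    and y: "sqrt k * \<rho> \<le> y" "y \<le> sqrt k * \<rho> + 1"
    and cd: "c \<in> words K n" "d \<in> words K n" "LCS c d \<le> \<gamma> * n"
    and s: "common_subseq (encode (inner_word K k \<rho> y) c) (encode (inner_word K k \<rho> y) d) s"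
  shows "(k + sqrt k) * len_cs s \<le> real (span_cs s) + 5 * \<gamma> * k * (n * T)"
proof -
  define \<delta> where "\<delta> = (2 * k + 2) * T / \<rho>"
  have "T > 0" using k \<rho> by (simp add: T_def)
  have "(k + sqrt k) * len_cs s \<le> real (span_cs s) + real (2 * n) * \<delta> + (k + sqrt k) * real (T * LCS c d)"
  proof (rule span_encode[where A = "{1..K}" and T = T, OF \<open>T > 0\<close>])
    fix a show "length (inner_word K k \<rho> y a) = T" by (simp add: inner_word_def T_def)
  next
    fix a b M
    assume "a \<in> {1..K}" "b \<in> {1..K}" "a \<noteq> b" "finite M" "strict_chain M" "fst ` M \<subseteq> {..<T}" "snd ` M \<subseteq> {..<T}"
      and "\<And>p. p \<in> M \<Longrightarrow> inner_word K k \<rho> y a ! fst p = inner_word K k \<rho> y b ! snd p"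
    then show "(k + sqrt k) * card M \<le> real (span_pos (fst ` M)) + real (span_pos (snd ` M)) + \<delta>"
      unfolding T_def \<delta>_def using k \<rho> y by (intro span_inner_words) auto
  qed (use cd s in \<open>auto simp: words_def \<delta>_def\<close>)
  \<comment> \<open>Since \<open>k \<ge> 2\<close> and \<open>k \<le> \<gamma> * \<rho>\<close>,
    \<open>2 * k + 2 \<le> 3 * k \<le> 3 / 2 * k * k \<le> 3 / 2 * \<gamma> * \<rho> *
    k\<close>.\<close>
  moreover have "\<delta> \<le> 3 / 2 * \<gamma> * k * T"
  proof -
    have "k \<le> \<gamma> * \<rho>" using \<rho> \<open>\<gamma> > 0\<close> by (simp add: field_simps)
    then have "real k * real k \<le> \<gamma> * \<rho> * real k" by (intro mult_right_mono) auto
    moreover have "2 * real k \<le> real k * real k" using k by (intro mult_right_mono) auto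
    moreover have "real k \<ge> 2" using k by simp
    ultimately have "2 * real k + 2 \<le> 3 / 2 * (\<gamma> * \<rho> * k)" by linarith
    then have "(2 * real k + 2) * T \<le> 3 / 2 * (\<gamma> * \<rho> * k) * T" by (intro mult_right_mono) auto
    then show ?thesis using \<rho> by (simp add: \<delta>_def field_simps)
  qed
  then have "real (2 * n) * \<delta> \<le> real (2 * n) * (3 / 2 * \<gamma> * k * T)" by (intro mult_left_mono) auto
  moreover have "(k + sqrt k) * real (T * LCS c d) \<le> (2 * real k) * (T * (\<gamma> * n))"
  proof (intro mult_mono)
    have "sqrt k \<le> k" using k by (intro real_le_lsqrt) (auto simp: power2_eq_square)
    then show "k + sqrt k \<le> 2 * real k" by simp
  qed (use cd \<open>\<gamma> > 0\<close> in \<open>auto intro: mult_left_mono\<close>)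
  ultimately show ?thesis by (simp add: algebra_simps)
qed

theorem theorem3p1:
  shows "\<exists>c::real. c > 0 \<and>
    (\<forall>(K::nat) (k::nat) (\<gamma>::real). K \<ge> 2 \<longrightarrow> k \<ge> 2 \<longrightarrow> \<gamma> > 0 \<longrightarrow>
      (\<exists>T::nat. real T \<le> c * (2 * real k / \<gamma>) ^ (2 * K + 2) \<and>
        (\<forall>(n::nat) (C1::nat list set).
           n \<ge> 1 \<longrightarrow> C1 \<subseteq> words K n \<longrightarrow> card C1 \<ge> 2 \<longrightarrow>
           real (LCS_code C1) = \<gamma> * real n \<longrightarrow>
           (\<exists>\<tau>::nat \<Rightarrow> nat list.
              inj_on \<tau> {1..K} \<and> (\<forall>a\<in>{1..K}. \<tau> a \<in> words k T) \<and>
              (let C2 = encode \<tau> ` C1; N = n * T in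
                (\<forall>c\<in>C2. \<forall>c'\<in>C2. c \<noteq> c' \<longrightarrow>
                   (\<forall>s. common_subseq c c' s \<longrightarrow>
                      real (span_cs s) \<ge> (real k + sqrt (real k)) * real (len_cs s)
                                         - 5 * \<gamma> * real k * real N)) \<and>
                real (LCS_code C2) \<le> (2 + 5 * \<gamma> * real k) / (real k + sqrt (real k)) * real N \<and>
                (2 + 5 * \<gamma> * real k) / (real k + sqrt (real k)) * real N
                  < (2 / (real k + sqrt (real k)) + 5 * \<gamma>) * real N)))))"
proof (intro exI[of _ "1::real"] conjI allI impI)
  fix K k :: nat and \<gamma> :: real
  assume K: "K \<ge> 2" and k: "k \<ge> 2" and \<gamma>: "\<gamma> > 0"
  define \<beta> where "\<beta> = real k + sqrt (real k)"
  have \<beta>: "\<beta> > k" "\<beta> > 0" using k by (auto simp: \<beta>_def add_pos_nonneg)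
  \<comment> \<open>\<open>T\<close> must be fixed before the code is known, so the bound on
    \<open>\<gamma>\<close> forced by \<open>LCS_code C1 \<le> n\<close> is extracted first.\<close>
  have small: "\<gamma> \<le> 1" if "n \<ge> 1" "C1 \<subseteq> words K n" "card C1 \<ge> 2" "real (LCS_code C1) = \<gamma> * real n"
    for n C1
  proof -
    obtain c1 c2 where "c1 \<in> C1" "LCS_code C1 = LCS c1 c2" using LCS_code_attained[OF \<open>card C1 \<ge> 2\<close>] by metis
    then have "LCS_code C1 \<le> n" using LCS_le_length[of c1 c2] that(2) by (auto simp: words_def)
    then have "\<gamma> * real n \<le> 1 * real n" using that(4) by simp
    then show ?thesis using that(1) by (simp add: mult_le_cancel_right)
  qed
  show "\<exists>T::nat. real T \<le> 1 * (2 * real k / \<gamma>) ^ (2 * K + 2) \<and>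
        (\<forall>(n::nat) (C1::nat list set).
           n \<ge> 1 \<longrightarrow> C1 \<subseteq> words K n \<longrightarrow> card C1 \<ge> 2 \<longrightarrow>
           real (LCS_code C1) = \<gamma> * real n \<longrightarrow>
           (\<exists>\<tau>::nat \<Rightarrow> nat list.
              inj_on \<tau> {1..K} \<and> (\<forall>a\<in>{1..K}. \<tau> a \<in> words k T) \<and>
              (let C2 = encode \<tau> ` C1; N = n * T in
                (\<forall>c\<in>C2. \<forall>c'\<in>C2. c \<noteq> c' \<longrightarrow>
                   (\<forall>s. common_subseq c c' s \<longrightarrow>
                      real (span_cs s) \<ge> (real k + sqrt (real k)) * real (len_cs s)
                                         - 5 * \<gamma> * real k * real N)) \<and>
                real (LCS_code C2) \<le> (2 + 5 * \<gamma> * real k) / (real k + sqrt (real k)) * real N \<and>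
                (2 + 5 * \<gamma> * real k) / (real k + sqrt (real k)) * real N
                  < (2 / (real k + sqrt (real k)) + 5 * \<gamma>) * real N)))"
  proof (cases "\<gamma> \<le> 1")
    \<comment> \<open>No code meets the hypotheses here, so only the length bound remains, and
      \<open>T = 0\<close> satisfies it.\<close>
    case False
    then show ?thesis using small \<gamma> by (intro exI[of _ 0]) auto
  next
    case True
    \<comment> \<open>The ratio of neighbouring scales, chosen to give
      \<open>k \<le> \<gamma> * \<rho>\<close>. As \<open>\<gamma> \<le> 1\<close>, rounding up
      still keeps it below \<open>2 * k / \<gamma>\<close>.\<close>
    define \<rho> where "\<rho> = nat \<lceil>k / \<gamma>\<rceil>"
    define y where "y = nat \<lceil>sqrt k * \<rho>\<rceil>"
    define T where "T = (k * \<rho> + y) * \<rho> ^ (2 * K)"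
    define \<tau> where "\<tau> = inner_word K k \<rho> y"
    have kg: "real k \<le> k / \<gamma>" using True \<gamma> k by (simp add: field_simps)
    have \<rho>1: "k / \<gamma> \<le> \<rho>" unfolding \<rho>_def by (rule real_nat_ceiling_ge)
    have \<rho>2: "\<rho> \<ge> 2" using \<rho>1 kg k by linarith
    have "\<rho> \<le> k / \<gamma> + 1" unfolding \<rho>_def using \<gamma> by (intro nat_ceiling_le_add_one) simp
    then have \<rho>3: "\<rho> \<le> 2 * k / \<gamma>" using kg k by simp
    have y1: "sqrt k * \<rho> \<le> y" unfolding y_def by (rule real_nat_ceiling_ge)
    have y2: "y \<le> sqrt k * \<rho> + 1" unfolding y_def by (intro nat_ceiling_le_add_one) simp
    have "sqrt k \<le> k" using k by (intro real_le_lsqrt) (auto simp: power2_eq_square)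
    then have "sqrt k * \<rho> \<le> real (k * \<rho>)" by (simp add: mult_right_mono)
    then have y3: "y \<le> k * \<rho>" unfolding y_def by (simp add: ceiling_le_iff nat_le_iff)
    have T0: "T > 0" using k \<rho>2 by (simp add: T_def)
    \<comment> \<open>\<open>y \<le> k * \<rho>\<close> gives
      \<open>T \<le> 2 * k * \<rho> ^ (2 * K + 1)\<close>, and both \<open>2 * k\<close> and
      \<open>\<rho>\<close> are at most \<open>2 * k / \<gamma>\<close>. Hence the constant
      \<open>1\<close> suffices.\<close>
    have "real T \<le> (2 * real k / \<gamma>) ^ (2 * K + 2)"
    proof -
      have "real (k * \<rho> + y) \<le> real (2 * k) * real \<rho>"
        using y3 unfolding of_nat_mult[symmetric] by (intro of_nat_mono) (simp add: mult.commute)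
      also have "\<dots> \<le> (2 * k / \<gamma>) * (2 * k / \<gamma>)"
        using \<rho>3 kg by (intro mult_mono) auto
      finally have "real (k * \<rho> + y) * real \<rho> ^ (2 * K) \<le> (2 * k / \<gamma>) * (2 * k / \<gamma>) * (2 * k / \<gamma>) ^ (2 * K)"
        using \<rho>3 \<gamma> by (intro mult_mono power_mono) auto
      then show ?thesis by (simp add: T_def power_add power2_eq_square mult.commute)
    qed
    moreover have "inj_on \<tau> {1..K}" unfolding \<tau>_def using k \<rho>2 by (rule inj_on_inner_word)
    moreover have \<tau>w: "\<forall>a\<in>{1..K}. \<tau> a \<in> words k T"
      unfolding \<tau>_def T_def using k inner_word_in_words by simp
    moreover have "(let C2 = encode \<tau> ` C1; N = n * T in
                (\<forall>c\<in>C2. \<forall>c'\<in>C2. c \<noteq> c' \<longrightarrow>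
                   (\<forall>s. common_subseq c c' s \<longrightarrow>
                      real (span_cs s) \<ge> (real k + sqrt (real k)) * real (len_cs s)
                                         - 5 * \<gamma> * real k * real N)) \<and>
                real (LCS_code C2) \<le> (2 + 5 * \<gamma> * real k) / (real k + sqrt (real k)) * real N \<and>
                (2 + 5 * \<gamma> * real k) / (real k + sqrt (real k)) * real N
                  < (2 / (real k + sqrt (real k)) + 5 * \<gamma>) * real N)"
      if n: "n \<ge> 1" and C1: "C1 \<subseteq> words K n" "card C1 \<ge> 2" "real (LCS_code C1) = \<gamma> * real n" for n C1
    proof -
      define N where "N = n * T"
      have N0: "N > 0" using n T0 by (simp add: N_def)
      have fin: "finite C1" using C1(2) by (metis card.infinite not_numeral_le_zero)
      have span: "\<beta> * len_cs s \<le> span_cs s + 5 * \<gamma> * k * N"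
        if "c \<in> C1" "d \<in> C1" "encode \<tau> c \<noteq> encode \<tau> d" "common_subseq (encode \<tau> c) (encode \<tau> d) s" for c d s
      proof -
        have "LCS c d \<le> LCS_code C1" using that fin by (intro LCS_le_LCS_code) auto
        then have "real (LCS c d) \<le> \<gamma> * n" using C1(3) by linarith
        then have "(k + sqrt k) * len_cs s \<le> real (span_cs s) + 5 * \<gamma> * k * (n * ((k * \<rho> + y) * \<rho> ^ (2 * K)))"
          using that C1(1) k \<gamma> \<rho>1 \<rho>2 y1 y2 unfolding \<tau>_def
          by (intro span_encode_inner_word[where c = c and d = d]) auto
        then show ?thesis by (simp add: \<beta>_def N_def T_def)
      qed
      have len\<tau>: "length (\<tau> a) = T" if "a \<in> {1..K}" for a
        using \<tau>w that by (auto simp: words_def)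
      \<comment> \<open>Keeps at least two codewords in the image, so that the maximum in
        \<open>LCS_code\<close> is attained by a distinct pair.\<close>
      have "inj_on (encode \<tau>) C1"
        using len\<tau> \<open>inj_on \<tau> {1..K}\<close> C1(1) by (intro inj_on_encode[of "{1..K}" \<tau> T C1 n]) (auto simp: words_def)
      then have "card (encode \<tau> ` C1) \<ge> 2" using C1(2) by (simp add: card_image)
      then obtain e1 e2 where "e1 \<in> encode \<tau> ` C1" "e2 \<in> encode \<tau> ` C1" "e1 \<noteq> e2"
        "LCS_code (encode \<tau> ` C1) = LCS e1 e2"
        by (rule LCS_code_attained)
      then obtain c d where cd: "c \<in> C1" "d \<in> C1" "encode \<tau> c \<noteq> encode \<tau> d"
        "LCS_code (encode \<tau> ` C1) = LCS (encode \<tau> c) (encode \<tau> d)" by blast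
      obtain s where s: "common_subseq (encode \<tau> c) (encode \<tau> d) s"
        "LCS (encode \<tau> c) (encode \<tau> d) = len_cs s" by (rule LCS_attained)
      have lenN: "length (encode \<tau> c) = N" if "c \<in> C1" for c
        using that C1(1) len\<tau> length_encode[of c \<tau> T] by (auto simp: words_def N_def subset_iff)
      \<comment> \<open>Comparing this trivial bound with the lower bound on the span limits the
        length of \<open>s\<close>.\<close>
      have "span_cs s \<le> N + N"
        using s(1) span_pos_le[of "fst s" N] span_pos_le[of "snd s" N] lenN[OF cd(1)] lenN[OF cd(2)]
        unfolding span_cs_def common_subseq_def by (intro add_mono) auto
      then have "\<beta> * LCS_code (encode \<tau> ` C1) \<le> (2 + 5 * \<gamma> * k) * N"
        using span[OF cd(1-3) s(1)] cd(4) s(2) by (simp add: algebra_simps)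
      then have "LCS_code (encode \<tau> ` C1) \<le> (2 + 5 * \<gamma> * k) / \<beta> * N"
        using \<beta> by (simp add: field_simps)
      \<comment> \<open>Strict because \<open>k < \<beta>\<close> and
        \<open>\<gamma> > 0\<close>.\<close>
      moreover have "(2 + 5 * \<gamma> * k) / \<beta> < 2 / \<beta> + 5 * \<gamma>"
        using \<beta> \<gamma> by (simp add: field_simps)
      then have "(2 + 5 * \<gamma> * k) / \<beta> * N < (2 / \<beta> + 5 * \<gamma>) * N"
        using N0 by (intro mult_strict_right_mono) auto
      ultimately show ?thesis
        unfolding Let_def \<beta>_def[symmetric] N_def[symmetric] using span by (fastforce simp: diff_le_eq)
    qed
    ultimately show ?thesis by (intro exI[of _ T]) auto
  qed
qed simp

end
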